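(* Let $\mathcal{G}$ be a finite simplicial graph with graph group $G\mathcal{G}$. Then the Bieri-Neumann-Strebel invariant $\Sigma^1(G\mathcal{G}) \subseteq S(G\mathcal{G})$ is a union of open simplices of the simplicial decomposition $\mathcal{SP}(G\mathcal{G})$ of the character sphere $S(G\mathcal{G})$. In particular, an open simplex $\sigma$ of $\mathcal{SP}(G\mathcal{G})$ is contained in $\Sigma^1(G\mathcal{G})$ if and only if the corresponding living subgraph $\mathcal{L}(\sigma)$ is a connected and dominating subgraph of $\mathcal{G}$.
   Context: For a finite simplicial graph $\mathcal{G}$ with vertex set $V(\mathcal{G})$, the graph group $G\mathcal{G}$ is $\langle V(\mathcal{G}) \mid xy=yx \text{ for all adjacent } x,y\in V(\mathcal{G})\rangle$; the elements of $V(\mathcal{G})$ are the standard generators. A character of a finitely generated group $G$ is a non-zero homomorphism $\chi: G\to\mathbb{R}$. Put $[\chi]=\{r\chi \mid r\in\mathbb{R},\ r>0\}$; the set $S(G)$ of all such rays is the character sphere, a sphere of dimension (rank of $G^{ab}$) $-1$. A character of $G\mathcal{G}$ is determined by its arbitrary values on $V(\mathcal{G})$, so $\mathrm{Hom}(G\mathcal{G},\mathbb{R})\cong\mathbb{R}^{V(\mathcal{G})}$ and $S(G\mathcal{G})\cong S^{|V(\mathcal{G})|-1}$. Definition of $\Sigma^1(G)$: choose a finite generating set of $G$ with Cayley graph $\mathcal{C}$ (on which $G$ acts by left multiplication); extend $\chi$ linearly over edges to $\tilde\chi:\mathcal{C}\to\mathbb{R}$, and let $\mathcal{C}_+(\chi)$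 be the maximal subgraph of $\mathcal{C}$ contained in $\tilde\chi^{-1}([0,\infty))$. Then $[\chi]\in\Sigma^1(G)$ if and only if $\mathcal{C}_+(\chi)$ is connected (this is independent of the finite generating set). The simplicial decomposition $\mathcal{SP}(G\mathcal{G})$ of the sphere $S(G\mathcal{G})$: its vertices are the intersections of the sphere with the positive and negative coordinate axes of $\mathbb{R}^{V(\mathcal{G})}$, and any $m$ vertices lying on linearly independent (positive or negative) coordinate axes span an $(m-1)$-simplex. Thus an open simplex $\sigma$ is given by a non-empty subset $A\subseteq V(\mathcal{G})$ and signs $\varepsilon_v\in\{\pm1\}$ for $v\in A$, and consists of all $[\chi]$ with $\varepsilon_v\chi(v)>0$ for $v\in A$ and $\chi(v)=0$ for $v\notin A$. The living subgraph $\mathcal{L}(\sigma)$ is the full (induced) subgraph of $\mathcal{G}$ on $A$. A subgraph $\mathcal{L}$ of $\mathcal{G}$ is dominating if every vertex $v$ of $\mathcal{G}$ not in $\mathcal{L}$ satisfies $d(v,\mathcal{L})=1$, i.e. is adjacent to a vertex of $\mathcal{L}$. *)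

theory Defs
  imports
    Complex_Main
    "HOL-Algebra.Generated_Groups"
    "Graph_Theory.Graph_Theory"
begin

section \<open>Groups given by generators and relations\<close>

text \<open>A letter \<open>(x, True)\<close> stands for the generator \<open>x\<close>, and \<open>(x, False)\<close> for its formal inverse.\<close>

type_synonym 'a gword = "('a \<times> bool) list"

definition gwords :: "'a set \<Rightarrow> 'a gword set" where
  "gwords S = lists (S \<times> UNIV)"

text \<open>The congruence on words over \<open>S\<close> generated by free cancellation and by the relations
  \<open>u = v\<close> for \<open>(u, v) \<in> R\<close>.\<close>

inductive_set pres_cong :: "'a set \<Rightarrow> ('a gword \<times> 'a gword) set \<Rightarrow> ('a gword \<times> 'a gword) set"
  for S R where
  refl: "w \<in> gwords S \<Longrightarrow> (w, w) \<in> pres_cong S R"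
| sym: "(u, v) \<in> pres_cong S R \<Longrightarrow> (v, u) \<in> pres_cong S R"
| trans: "(u, v) \<in> pres_cong S R \<Longrightarrow> (v, w) \<in> pres_cong S R \<Longrightarrow> (u, w) \<in> pres_cong S R"
| append: "(u, u') \<in> pres_cong S R \<Longrightarrow> (v, v') \<in> pres_cong S R \<Longrightarrow> (u @ v, u' @ v') \<in> pres_cong S R"
| cancel: "x \<in> S \<Longrightarrow> ([(x, b), (x, \<not> b)], []) \<in> pres_cong S R"
| rel: "(u, v) \<in> R \<Longrightarrow> (u, v) \<in> pres_cong S R"

definition presented_group ::
  "'a set \<Rightarrow> ('a gword \<times> 'a gword) set \<Rightarrow> 'a gword set monoid" where
  "presented_group S R =
     \<lparr> carrier = gwords S // pres_cong S R,
       monoid.mult = (\<lambda>U V. \<Union>u\<in>U. \<Union>v\<in>V. pres_cong S R `` {u @ v}),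
       one = pres_cong S R `` {[]} \<rparr>"


section \<open>Graph groups\<close>

definition commutation_relations :: "'a pair_pre_digraph \<Rightarrow> ('a gword \<times> 'a gword) set" where
  "commutation_relations \<G> =
     {([(x, True), (y, True)], [(y, True), (x, True)]) | x y. (x, y) \<in> parcs \<G>}"

definition graph_group :: "'a pair_pre_digraph \<Rightarrow> 'a gword set monoid" where
  "graph_group \<G> = presented_group (pverts \<G>) (commutation_relations \<G>)"

definition standard_generator :: "'a pair_pre_digraph \<Rightarrow> 'a \<Rightarrow> 'a gword set" where
  "standard_generator \<G> v = pres_cong (pverts \<G>) (commutation_relations \<G>) `` {[(v, True)]}"


section \<open>Characters and the character sphere\<close>

definition real_group :: "real monoid" where
  "real_group = \<lparr> carrier = UNIV, monoid.mult = (+), one = 0 \<rparr>"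

text \<open>Characters are taken to be extensional, so that two of them are equal as soon as they agree
  on the carrier.\<close>

definition characters :: "('g, 'm) monoid_scheme \<Rightarrow> ('g \<Rightarrow> real) set" where
  "characters G =
     {\<chi> \<in> hom G real_group \<inter> extensional (carrier G). \<exists>g\<in>carrier G. \<chi> g \<noteq> 0}"

definition ray :: "('g, 'm) monoid_scheme \<Rightarrow> ('g \<Rightarrow> real) \<Rightarrow> ('g \<Rightarrow> real) set" where
  "ray G \<chi> = {\<lambda>g\<in>carrier G. r * \<chi> g | r. r > 0}"

definition character_sphere :: "('g, 'm) monoid_scheme \<Rightarrow> ('g \<Rightarrow> real) set set" where
  "character_sphere G = ray G ` characters G"


section \<open>The Bieri-Neumann-Strebel invariant\<close>

text \<open>The pair \<open>(g, x)\<close> is the edge from \<open>g\<close> to \<open>g x\<close>. The library's graph connectedness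
  disregards the direction of arcs.\<close>

definition cayley_graph :: "('g, 'm) monoid_scheme \<Rightarrow> 'g set \<Rightarrow> ('g, 'g \<times> 'g) pre_digraph" where
  "cayley_graph G X =
     \<lparr> verts = carrier G, arcs = carrier G \<times> X,
       tail = fst, head = (\<lambda>(g, x). g \<otimes>\<^bsub>G\<^esub> x) \<rparr>"

text \<open>The linear extension of \<open>\<chi>\<close>, evaluated at the point of the edge \<open>e\<close> with parameter \<open>t\<close>
  (running from the tail at 0 to the head at 1).\<close>

definition edge_extension :: "('g, 'e) pre_digraph \<Rightarrow> ('g \<Rightarrow> real) \<Rightarrow> 'e \<Rightarrow> real \<Rightarrow> real" where
  "edge_extension C \<chi> e t = (1 - t) * \<chi> (tail C e) + t * \<chi> (head C e)"

definition nonneg_subgraph :: "('g, 'e) pre_digraph \<Rightarrow> ('g \<Rightarrow> real) \<Rightarrow> ('g, 'e) pre_digraph" where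
  "nonneg_subgraph C \<chi> =
     C \<lparr> verts := {g \<in> verts C. \<chi> g \<ge> 0},
         arcs := {e \<in> arcs C. \<forall>t\<in>{0..1}. edge_extension C \<chi> e t \<ge> 0} \<rparr>"

definition finite_generating_set :: "('g, 'm) monoid_scheme \<Rightarrow> 'g set \<Rightarrow> bool" where
  "finite_generating_set G X \<longleftrightarrow> finite X \<and> X \<subseteq> carrier G \<and> generate G X = carrier G"

text \<open>The chosen finite generating set \<open>X\<close> is kept as a parameter.\<close>

definition Sigma1 :: "('g, 'm) monoid_scheme \<Rightarrow> 'g set \<Rightarrow> ('g \<Rightarrow> real) set set" where
  "Sigma1 G X =
     {ray G \<chi> | \<chi>. \<chi> \<in> characters G \<and>
        Digraph_Component.connected (nonneg_subgraph (cayley_graph G X) \<chi>)}"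


section \<open>The simplicial decomposition of the character sphere of a graph group\<close>

definition signed_vertex_set :: "'a pair_pre_digraph \<Rightarrow> 'a set \<Rightarrow> ('a \<Rightarrow> real) \<Rightarrow> bool" where
  "signed_vertex_set \<G> A \<epsilon> \<longleftrightarrow> A \<noteq> {} \<and> A \<subseteq> pverts \<G> \<and> \<epsilon> \<in> A \<rightarrow>\<^sub>E {1, -1}"

definition open_simplex ::
  "'a pair_pre_digraph \<Rightarrow> 'a set \<Rightarrow> ('a \<Rightarrow> real) \<Rightarrow> ('a gword set \<Rightarrow> real) set set" where
  "open_simplex \<G> A \<epsilon> =
     {ray (graph_group \<G>) \<chi> | \<chi>. \<chi> \<in> characters (graph_group \<G>) \<and>
        (\<forall>v\<in>A. \<epsilon> v * \<chi> (standard_generator \<G> v) > 0) \<and>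
        (\<forall>v\<in>pverts \<G> - A. \<chi> (standard_generator \<G> v) = 0)}"

definition open_simplices :: "'a pair_pre_digraph \<Rightarrow> ('a gword set \<Rightarrow> real) set set set" where
  "open_simplices \<G> = {open_simplex \<G> A \<epsilon> | A \<epsilon>. signed_vertex_set \<G> A \<epsilon>}"

definition living_subgraph :: "'a pair_pre_digraph \<Rightarrow> 'a set \<Rightarrow> ('a, 'a \<times> 'a) pre_digraph" where
  "living_subgraph \<G> A = induce_subgraph (with_proj \<G>) A"

definition dominating :: "('a, 'b) pre_digraph \<Rightarrow> ('a, 'b) pre_digraph \<Rightarrow> bool" where
  "dominating L G \<longleftrightarrow> (\<forall>v \<in> verts G - verts L. \<exists>w \<in> verts L. v \<rightarrow>\<^bsub>G\<^esub> w)"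

end

theory Submission
  imports Defs
begin

text \<open>If the living subgraph \<open>\<L>\<close> is connected and dominating, then for a living vertex \<open>t\<close>
  (inverted if necessary so that \<open>\<chi>(t) > 0\<close>) and any generator \<open>x\<close> there is a path from
  \<open>t ^ N\<close> to \<open>x t ^ N\<close> high up in the Cayley graph: walk along \<open>\<L>\<close>, exchanging a power of
  one vertex for a power of an adjacent one, until a power of a vertex commuting with \<open>x\<close> is reached,
  multiply by \<open>x\<close>, and walk back. Hence any path from 1 to \<open>g\<close> can be lifted to a path from
  \<open>t ^ N\<close> to \<open>g t ^ N\<close> in the half space.

  If \<open>\<L>\<close> is disconnected, or some dead vertex has no living neighbour, then \<open>\<chi>\<close> factors through a
  homomorphism to a free product of two copies of the reals. Normal forms there show that the half
  space is disconnected.\<close>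

text \<open>Well-formedness keeps both ends of every arc among the vertices, so the closure
  restricted to the vertex set, which defines reachability, agrees there with the plain
  closure.\<close>

lemma connected_iff_rtrancl:
  assumes "wf_digraph C"
  shows "Digraph_Component.connected C \<longleftrightarrow> verts C \<noteq> {} \<and>
    (\<forall>u\<in>verts C. \<forall>v\<in>verts C. (u, v) \<in> (parcs (mk_symmetric C))\<^sup>*)"
proof -
  interpret pair_wf_digraph "mk_symmetric C"
    using assms by (rule wf_digraph.wellformed_mk_symmetric)
  have "(u, v) \<in> rtrancl_on (verts C) (parcs (mk_symmetric C)) \<longleftrightarrow> (u, v) \<in> (parcs (mk_symmetric C))\<^sup>*"
    if "u \<in> verts C" "v \<in> verts C" for u v
    using that in_arcsD2 rtrancl_consistent_rtrancl_on[of u v _ "verts C"] rtrancl_on_rtranclI[of u v]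
    by (metis pverts_mk_symmetric)
  then show ?thesis
    by (simp add: Digraph_Component.connected_def strongly_connected_def reachable_def)
qed


section \<open>Paths in half spaces of a Cayley graph\<close>

locale height_group = group G for G (structure) +
  fixes \<chi> :: "'a \<Rightarrow> real"
  assumes height_mult: "\<And>x y. x \<in> carrier G \<Longrightarrow> y \<in> carrier G \<Longrightarrow> \<chi> (x \<otimes> y) = \<chi> x + \<chi> y"
begin

text \<open>Edges may be crossed against the generator, so paths can be reversed. The level
  \<open>c\<close> is a parameter because paths are translated up and down.\<close>

definition above_adj :: "'a set \<Rightarrow> real \<Rightarrow> 'a rel" where
  "above_adj X c = {(g, h). g \<in> carrier G \<and> h \<in> carrier G \<and> \<chi> g \<ge> c \<and> \<chi> h \<ge> c \<and>
     (\<exists>x\<in>X. h = g \<otimes> x \<or> g = h \<otimes> x)}"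

abbreviation above_path :: "'a set \<Rightarrow> real \<Rightarrow> 'a rel" where
  "above_path X c \<equiv> (above_adj X c)\<^sup>*"

lemma height_one [simp]: "\<chi> \<one> = 0"
  using height_mult[of \<one> \<one>] by simp

lemma height_inv [simp]: "x \<in> carrier G \<Longrightarrow> \<chi> (inv x) = - \<chi> x"
  using height_mult[of x "inv x"] by simp

lemma height_pow [simp]: "x \<in> carrier G \<Longrightarrow> \<chi> (x [^] (n::nat)) = n * \<chi> x"
  by (induction n) (simp_all add: height_mult algebra_simps)

lemma above_path_sym: "(g, h) \<in> above_path X c \<Longrightarrow> (h, g) \<in> above_path X c"
proof -
  have "sym (above_adj X c)"
    by (auto simp: above_adj_def sym_def)
  then show "(g, h) \<in> above_path X c \<Longrightarrow> (h, g) \<in> above_path X c"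
    by (meson sym_rtrancl symD)
qed

lemma above_path_mono:
  assumes "(g, h) \<in> above_path X c" "d \<le> c"
  shows "(g, h) \<in> above_path X d"
proof -
  have "above_adj X c \<subseteq> above_adj X d"
    using assms(2) by (auto simp: above_adj_def)
  then show ?thesis
    using assms(1) rtrancl_mono by blast
qed

text \<open>Edges come from right multiplication, so left multiplication by \<open>k\<close> maps
  edges to edges and shifts every height by \<open>\<chi> k\<close>.\<close>

lemma above_path_translate:
  assumes "(g, h) \<in> above_path X c" "k \<in> carrier G" "X \<subseteq> carrier G"
  shows "(k \<otimes> g, k \<otimes> h) \<in> above_path X (\<chi> k + c)"
  using assms(1)
proof (induction rule: rtrancl_induct)
  case (step h h')
  then have "(k \<otimes> h, k \<otimes> h') \<in> above_adj X (\<chi> k + c)"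
    using assms(2,3) by (auto simp: above_adj_def height_mult m_assoc[symmetric] subset_iff)
  with step.IH show ?case
    by (rule rtrancl_into_rtrancl)
qed simp

lemma above_path_generator:
  assumes "x \<in> X" "X \<subseteq> carrier G"
  shows "(\<one>, x) \<in> above_path X (min 0 (\<chi> x))" "(\<one>, inv x) \<in> above_path X (min 0 (- \<chi> x))"
proof -
  have x: "x \<in> carrier G"
    using assms by auto
  then have "(\<one>, x) \<in> above_adj X (min 0 (\<chi> x))"
    using assms by (auto simp: above_adj_def intro!: bexI[of _ x])
  then show "(\<one>, x) \<in> above_path X (min 0 (\<chi> x))" ..
  have "(\<one>, inv x) \<in> above_adj X (min 0 (- \<chi> x))"
    using assms x by (auto simp: above_adj_def intro!: bexI[of _ x])
  then show "(\<one>, inv x) \<in> above_path X (min 0 (- \<chi> x))" ..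
qed

text \<open>A path from \<open>\<one>\<close> to \<open>g\<close> is finite and so has a lowest
  point. For a product, the path to \<open>h1\<close> is followed by the \<open>h1\<close>-translate
  of the path to \<open>h2\<close>.\<close>

lemma above_path_exists:
  assumes "X \<subseteq> carrier G" "g \<in> generate G X"
  shows "\<exists>c. (\<one>, g) \<in> above_path X c"
  using assms(2)
proof (induction rule: generate.induct)
  case (eng h1 h2)
  then obtain c1 c2 where c: "(\<one>, h1) \<in> above_path X c1" "(\<one>, h2) \<in> above_path X c2"
    by blast
  have h: "h1 \<in> carrier G" "h2 \<in> carrier G"
    using eng.hyps assms(1) generate_in_carrier by blast+
  define d where "d = min c1 (\<chi> h1 + c2)"
  have "(h1 \<otimes> \<one>, h1 \<otimes> h2) \<in> above_path X (\<chi> h1 + c2)"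
    using c(2) h(1) assms(1) by (rule above_path_translate)
  then have "(h1, h1 \<otimes> h2) \<in> above_path X d"
    using h by (auto simp: d_def intro: above_path_mono)
  moreover have "(\<one>, h1) \<in> above_path X d"
    using c(1) by (auto simp: d_def intro: above_path_mono)
  ultimately show ?case
    by (meson rtrancl_trans)
qed (use assms above_path_generator in blast)+

lemma above_path_pow:
  assumes "(\<one>, t) \<in> above_path X 0" "t \<in> carrier G" "\<chi> t \<ge> 0" "X \<subseteq> carrier G"
  shows "(\<one>, t [^] (n::nat)) \<in> above_path X 0"
proof (induction n)
  case (Suc n)
  have "(t [^] n \<otimes> \<one>, t [^] n \<otimes> t) \<in> above_path X (\<chi> (t [^] n) + 0)"
    using assms by (intro above_path_translate) auto
  then have "(t [^] n \<otimes> \<one>, t [^] n \<otimes> t) \<in> above_path X 0"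
    by (rule above_path_mono) (use assms in auto)
  with Suc show ?case
    using assms by simp
qed simp

text \<open>The basic climbing move: a translate of the path along powers of \<open>t\<close>, which
  never dips below its starting point.\<close>

lemma above_path_mult_pow:
  assumes "(\<one>, t) \<in> above_path X 0" "t \<in> carrier G" "\<chi> t \<ge> 0" "X \<subseteq> carrier G"
    "g \<in> carrier G"
  shows "(g, g \<otimes> t [^] (n::nat)) \<in> above_path X (\<chi> g)"
  using above_path_translate[OF above_path_pow[OF assms(1-4), of n] assms(5,4)] assms by simp

lemma exists_generator_nonzero_height:
  assumes "X \<subseteq> carrier G" "generate G X = carrier G" "\<exists>g\<in>carrier G. \<chi> g \<noteq> 0"
  shows "\<exists>x\<in>X. \<chi> x \<noteq> 0"
proof (rule ccontr)
  assume *: "\<not> (\<exists>x\<in>X. \<chi> x \<noteq> 0)"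
  have "\<chi> g = 0" if "g \<in> generate G X" for g
    using that
  proof (induction rule: generate.induct)
    case (eng h1 h2)
    then show ?case
      using assms(2) by (simp add: height_mult)
  qed (use * assms(1) in auto)
  then show False
    using assms by auto
qed

lemma exists_positive_letter:
  assumes "X \<subseteq> carrier G" "generate G X = carrier G" "\<exists>g\<in>carrier G. \<chi> g \<noteq> 0"
  shows "\<exists>t\<in>carrier G. \<chi> t > 0 \<and> (\<one>, t) \<in> above_path X 0"
proof -
  obtain x where x: "x \<in> X" "\<chi> x \<noteq> 0" "x \<in> carrier G"
    using exists_generator_nonzero_height[OF assms] assms(1) by blast
  show ?thesis
  proof (cases "\<chi> x > 0")
    case True
    then show ?thesis
      using above_path_generator(1)[OF x(1) assms(1)] x by (auto simp: min_def)
  next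
    case False
    then show ?thesis
      using above_path_generator(2)[OF x(1) assms(1)] x
      by (intro bexI[of _ "inv x"]) (auto simp: min_def)
  qed
qed

text \<open>Since \<open>\<one>\<close> has height 0 and paths are reversible, reachability from
  \<open>\<one>\<close> amounts to connectedness of the half space.\<close>

definition half_connected :: "'a set \<Rightarrow> bool" where
  "half_connected X \<longleftrightarrow> (\<forall>g\<in>carrier G. \<chi> g \<ge> 0 \<longrightarrow> (\<one>, g) \<in> above_path X 0)"

text \<open>Conjugation by a high power of a letter \<open>t\<close> of positive height lifts a path of bounded depth
  into the half space, and keeps the height of its endpoint.\<close>

lemma half_connectedI_bounded_depth:
  assumes X: "X \<subseteq> carrier G" "generate G X = carrier G" "\<exists>g\<in>carrier G. \<chi> g \<noteq> 0"
    and K: "\<And>g. g \<in> carrier G \<Longrightarrow> \<chi> g \<ge> 0 \<Longrightarrow> (\<one>, g) \<in> above_path X (- K)"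
  shows "half_connected X"
  unfolding half_connected_def
proof (intro ballI impI)
  fix g assume g: "g \<in> carrier G" "\<chi> g \<ge> 0"
  obtain t where t: "t \<in> carrier G" "\<chi> t > 0" "(\<one>, t) \<in> above_path X 0"
    using exists_positive_letter[OF X] by blast
  obtain N :: nat where N: "K < N * \<chi> t"
    using ex_less_of_nat_mult[OF t(2)] by blast
  define s where "s = t [^] N"
  have s: "s \<in> carrier G" "\<chi> s = N * \<chi> t"
    using t by (auto simp: s_def)
  have "(\<one>, inv s \<otimes> (g \<otimes> s)) \<in> above_path X (- K)"
    using s g by (intro K) (auto simp: height_mult)
  then have "(s \<otimes> \<one>, s \<otimes> (inv s \<otimes> (g \<otimes> s))) \<in> above_path X (\<chi> s + - K)"
    using s X by (intro above_path_translate)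
  then have "(s, g \<otimes> s) \<in> above_path X (\<chi> s + - K)"
    using s g by (simp add: m_assoc[symmetric])
  then have "(s, g \<otimes> s) \<in> above_path X 0"
    by (rule above_path_mono) (use s N in simp)
  \<comment> \<open>The ends \<open>s\<close> and \<open>g \<otimes> s\<close> of the lifted path
    are joined to \<open>\<one>\<close> and \<open>g\<close> by climbing along powers of
    \<open>t\<close>.\<close>
  moreover have "(\<one>, s) \<in> above_path X 0"
    unfolding s_def using t X by (intro above_path_pow) auto
  moreover have "(g, g \<otimes> s) \<in> above_path X (\<chi> g)"
    unfolding s_def using t X g by (intro above_path_mult_pow) auto
  then have "(g \<otimes> s, g) \<in> above_path X 0"
    using g by (meson above_path_mono above_path_sym)
  ultimately show "(\<one>, g) \<in> above_path X 0"
    by (meson rtrancl_trans)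
qed

text \<open>Each \<open>Y\<close>-edge is replaced by a translate of a fixed \<open>X\<close>-path.
  As \<open>Y\<close> is finite, one bound \<open>K\<close> on the extra depth serves all edges and
  hence all paths.\<close>

lemma above_path_change_generators:
  assumes X: "X \<subseteq> carrier G" and Y: "Y \<subseteq> generate G X" "finite Y"
  obtains K where "\<And>g h c. (g, h) \<in> above_path Y c \<Longrightarrow> (g, h) \<in> above_path X (c - K)"
proof -
  have "\<forall>y\<in>Y. \<exists>c. (\<one>, y) \<in> above_path X c"
    using above_path_exists[OF X] Y by blast
  then obtain d where d: "\<And>y. y \<in> Y \<Longrightarrow> (\<one>, y) \<in> above_path X (d y)"
    by metis
  define K where "K = (\<Sum>y\<in>Y. \<bar>d y\<bar>)"
  have dK: "- K \<le> d y" if "y \<in> Y" for y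
    using member_le_sum[of y Y "\<lambda>y. \<bar>d y\<bar>"] that Y by (auto simp: K_def)
  have K: "(\<one>, y) \<in> above_path X (- K)" if "y \<in> Y" for y
    using above_path_mono[OF d[OF that] dK[OF that]] .
  have edge: "(g, g \<otimes> y) \<in> above_path X (c - K)" if "y \<in> Y" "g \<in> carrier G" "\<chi> g \<ge> c" for g y c
  proof -
    have "(g \<otimes> \<one>, g \<otimes> y) \<in> above_path X (\<chi> g + - K)"
      using K that X by (intro above_path_translate)
    then have "(g \<otimes> \<one>, g \<otimes> y) \<in> above_path X (c - K)"
      by (rule above_path_mono) (use that in simp)
    then show ?thesis
      using that by simp
  qed
  have "(g, h) \<in> above_path X (c - K)" if "(g, h) \<in> above_path Y c" for g h c
    using that
  proof (induction rule: rtrancl_induct)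
    case (step h h')
    then have "(h, h') \<in> above_path X (c - K)"
      using edge above_path_sym by (fastforce simp: above_adj_def)
    with step.IH show ?case
      by (rule rtrancl_trans)
  qed simp
  with that show ?thesis
    by blast
qed

text \<open>Rewriting \<open>Y\<close>-paths as \<open>X\<close>-paths costs a bounded depth, which
  \<open>half_connectedI_bounded_depth\<close> absorbs. Used in both directions, this gives
  independence of the finite generating set.\<close>

lemma half_connected_change_generators:
  assumes "X \<subseteq> carrier G" "generate G X = carrier G" "\<exists>g\<in>carrier G. \<chi> g \<noteq> 0"
    and "Y \<subseteq> carrier G" "finite Y" "half_connected Y"
  shows "half_connected X"
proof -
  obtain K where "\<And>g h c. (g, h) \<in> above_path Y c \<Longrightarrow> (g, h) \<in> above_path X (c - K)"
    using above_path_change_generators[of X Y] assms by metis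
  then have "(\<one>, g) \<in> above_path X (0 - K)" if "g \<in> carrier G" "\<chi> g \<ge> 0" for g
    using that assms(6) unfolding half_connected_def by blast
  then show ?thesis
    using half_connectedI_bounded_depth[OF assms(1-3), of K] by simp
qed

lemma connected_nonneg_subgraph_iff:
  assumes "X \<subseteq> carrier G"
  shows "Digraph_Component.connected (nonneg_subgraph (cayley_graph G X) \<chi>) \<longleftrightarrow> half_connected X"
proof -
  let ?C = "nonneg_subgraph (cayley_graph G X) \<chi>"
  \<comment> \<open>An affine function is non-negative on the unit interval iff it is so at both
    ends; hence an arc survives iff both its ends do.\<close>
  have seg: "(\<forall>t\<in>{0..1}. (1 - t) * a + t * b \<ge> 0) \<longleftrightarrow> a \<ge> 0 \<and> b \<ge> 0" for a b :: real
    by (auto dest: bspec[of _ _ 0] bspec[of _ _ 1])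
  have ends: "verts ?C = {g \<in> carrier G. \<chi> g \<ge> 0}"
    "arcs ?C = {(g, x). g \<in> carrier G \<and> x \<in> X \<and> \<chi> g \<ge> 0 \<and> \<chi> (g \<otimes> x) \<ge> 0}"
    "tail ?C = fst" "head ?C = (\<lambda>(g, x). g \<otimes> x)"
    by (auto simp: nonneg_subgraph_def cayley_graph_def edge_extension_def seg)
  have wf: "wf_digraph ?C"
    by unfold_locales (use assms in \<open>auto simp: ends\<close>)
  have adj: "parcs (mk_symmetric ?C) = above_adj X 0"
    using assms by (auto simp: parcs_mk_symmetric ends above_adj_def)
  have "Digraph_Component.connected ?C \<longleftrightarrow>
      (\<forall>u\<in>verts ?C. \<forall>v\<in>verts ?C. (u, v) \<in> above_path X 0)"
    unfolding connected_iff_rtrancl[OF wf] adj by (auto simp: ends intro!: exI[of _ \<one>])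
  also have "\<dots> \<longleftrightarrow> half_connected X"
  proof
    assume "half_connected X"
    then have "(\<one>, u) \<in> above_path X 0" if "u \<in> verts ?C" for u
      using that by (auto simp: half_connected_def ends)
    then show "\<forall>u\<in>verts ?C. \<forall>v\<in>verts ?C. (u, v) \<in> above_path X 0"
      by (meson above_path_sym rtrancl_trans)
  qed (auto simp: half_connected_def ends)
  finally show ?thesis .
qed

text \<open>From \<open>s ^ N\<close> climb to \<open>s ^ N s' ^ M = s' ^ M s ^ N\<close>, then descend to \<open>s' ^ M\<close>.\<close>

lemma above_path_commuting_powers:
  fixes N :: nat
  assumes X: "X \<subseteq> carrier G"
    and s: "s \<in> carrier G" "\<chi> s > 0" "(\<one>, s) \<in> above_path X 0"
    and s': "s' \<in> carrier G" "\<chi> s' > 0" "(\<one>, s') \<in> above_path X 0"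
    and comm: "s \<otimes> s' = s' \<otimes> s"
  shows "\<exists>M::nat. (s [^] N, s' [^] M) \<in> above_path X (N * \<chi> s) \<and> N * \<chi> s \<le> M * \<chi> s'"
proof -
  \<comment> \<open>\<open>M\<close> is so large that the descent to \<open>s' [^] M\<close> ends
    above the starting height.\<close>
  obtain M :: nat where M: "N * \<chi> s < M * \<chi> s'"
    using ex_less_of_nat_mult[OF s'(2)] by blast
  have "(s [^] N, s [^] N \<otimes> s' [^] M) \<in> above_path X (N * \<chi> s)"
    using above_path_mult_pow[of s' X "s [^] N" M] s s' X by simp
  moreover have "(s' [^] M, s' [^] M \<otimes> s [^] N) \<in> above_path X (M * \<chi> s')"
    using above_path_mult_pow[of s X "s' [^] M" N] s s' X by simp
  moreover have "s [^] N \<otimes> s' [^] M = s' [^] M \<otimes> s [^] N"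
    using comm s(1) s'(1) by (metis group_commutes_pow nat_pow_closed)
  ultimately show ?thesis
    using M by (metis above_path_mono above_path_sym less_imp_le rtrancl_trans)
qed

end

section \<open>Presented groups\<close>

locale group_presentation =
  fixes S :: "'a set" and R :: "('a gword \<times> 'a gword) set"
  assumes relations_subset: "R \<subseteq> gwords S \<times> gwords S"
begin

abbreviation word_class :: "'a gword \<Rightarrow> 'a gword set" where
  "word_class w \<equiv> pres_cong S R `` {w}"

lemma gwords_simps [simp]:
  "[] \<in> gwords S" "x # w \<in> gwords S \<longleftrightarrow> fst x \<in> S \<and> w \<in> gwords S"
  "u @ v \<in> gwords S \<longleftrightarrow> u \<in> gwords S \<and> v \<in> gwords S"
  by (auto simp: gwords_def mem_Times_iff)

lemma pres_cong_gwords: "(u, v) \<in> pres_cong S R \<Longrightarrow> u \<in> gwords S \<and> v \<in> gwords S"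
  by (induction rule: pres_cong.induct) (use relations_subset in auto)

lemma equiv_pres_cong: "equiv (gwords S) (pres_cong S R)"
proof (rule equivI)
  show "pres_cong S R \<subseteq> gwords S \<times> gwords S"
    using pres_cong_gwords by auto
  show "refl_on (gwords S) (pres_cong S R)"
    by (auto intro: refl_onI pres_cong.refl)
  show "sym (pres_cong S R)"
    by (auto intro: symI pres_cong.sym)
  show "trans (pres_cong S R)"
    by (auto intro: transI pres_cong.trans)
qed

lemma word_class_eq_iff:
  "u \<in> gwords S \<Longrightarrow> v \<in> gwords S \<Longrightarrow> word_class u = word_class v \<longleftrightarrow> (u, v) \<in> pres_cong S R"
  using equiv_pres_cong eq_equiv_class_iff by fastforce

lemma carrier_presented_group: "carrier (presented_group S R) = word_class ` gwords S"
  by (auto simp: presented_group_def quotient_def)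

lemma word_class_in_carrier [simp]: "w \<in> gwords S \<Longrightarrow> word_class w \<in> carrier (presented_group S R)"
  by (simp add: carrier_presented_group)

lemma one_presented_group: "\<one>\<^bsub>presented_group S R\<^esub> = word_class []"
  by (simp add: presented_group_def)

text \<open>The union over all representatives collapses because their concatenations all lie in one
  class.\<close>

lemma mult_word_class:
  assumes "u \<in> gwords S" "v \<in> gwords S"
  shows "word_class u \<otimes>\<^bsub>presented_group S R\<^esub> word_class v = word_class (u @ v)"
proof -
  have "word_class (u' @ v') = word_class (u @ v)" if "u' \<in> word_class u" "v' \<in> word_class v" for u' v'
    using that by (intro equiv_class_eq[OF equiv_pres_cong])
      (auto intro: pres_cong.append pres_cong.sym)
  moreover have "u \<in> word_class u" "v \<in> word_class v"
    using assms by (auto intro: pres_cong.refl)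
  ultimately have "(\<Union>u'\<in>word_class u. \<Union>v'\<in>word_class v. word_class (u' @ v')) = word_class (u @ v)"
    by blast
  then show ?thesis
    by (simp add: presented_group_def)
qed

text \<open>The inverse is the reversed word with every letter flipped. \<open>groupI\<close> asks
  for left inverses.\<close>

lemma pres_cong_inverse_left: "w \<in> gwords S \<Longrightarrow> \<exists>u\<in>gwords S. (u @ w, []) \<in> pres_cong S R"
proof (induction w)
  case Nil
  then show ?case
    by (auto intro!: bexI[of _ "[]"] pres_cong.refl)
next
  case (Cons x w)
  then obtain u where u: "u \<in> gwords S" "(u @ w, []) \<in> pres_cong S R" and x: "fst x \<in> S" "w \<in> gwords S"
    by auto
  have "([(fst x, \<not> snd x), (fst x, \<not> \<not> snd x)], []) \<in> pres_cong S R"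
    using x by (intro pres_cong.cancel)
  then have "(u @ ([(fst x, \<not> snd x), x] @ w), u @ ([] @ w)) \<in> pres_cong S R"
    using u x by (intro pres_cong.append pres_cong.refl) auto
  with u(2) have "((u @ [(fst x, \<not> snd x)]) @ x # w, []) \<in> pres_cong S R"
    by (auto intro: pres_cong.trans)
  with u x show ?case
    by (intro bexI[of _ "u @ [(fst x, \<not> snd x)]"]) auto
qed

lemma group_presented_group: "group (presented_group S R)"
proof (rule groupI)
  fix g assume "g \<in> carrier (presented_group S R)"
  then obtain w where w: "w \<in> gwords S" "g = word_class w"
    by (auto simp: carrier_presented_group)
  then obtain u where "u \<in> gwords S" "(u @ w, []) \<in> pres_cong S R"
    using pres_cong_inverse_left by blast
  then show "\<exists>h\<in>carrier (presented_group S R).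
      h \<otimes>\<^bsub>presented_group S R\<^esub> g = \<one>\<^bsub>presented_group S R\<^esub>"
    using w by (intro bexI[of _ "word_class u"])
      (auto simp: one_presented_group mult_word_class word_class_eq_iff)
qed (auto simp: carrier_presented_group one_presented_group mult_word_class)

lemma inv_word_class_letter:
  assumes "x \<in> S"
  shows "inv\<^bsub>presented_group S R\<^esub> word_class [(x, b)] = word_class [(x, \<not> b)]"
proof -
  interpret group "presented_group S R"
    by (rule group_presented_group)
  have "([(x, \<not> b), (x, b)], []) \<in> pres_cong S R"
    using pres_cong.cancel[OF assms, of "\<not> b" R] by simp
  then show ?thesis
    using assms by (intro inv_equality)
      (auto simp: one_presented_group mult_word_class word_class_eq_iff)
qed

lemma generate_presented_group:
  "generate (presented_group S R) ((\<lambda>x. word_class [(x, True)]) ` S) = carrier (presented_group S R)"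
    (is "generate ?G ?X = _")
proof
  interpret group ?G
    by (rule group_presented_group)
  show "generate ?G ?X \<subseteq> carrier ?G"
    by (rule generate_incl) auto
  have letter: "word_class [(x, b)] \<in> generate ?G ?X" if "x \<in> S" for x b
  proof (cases b)
    case False
    then show ?thesis
      using that generate.inv[of "word_class [(x, True)]" ?X ?G] by (simp add: inv_word_class_letter)
  qed (use that in \<open>auto intro: generate.incl\<close>)
  have "word_class w \<in> generate ?G ?X" if "w \<in> gwords S" for w
    using that
  proof (induction w)
    case Nil
    then show ?case
      by (metis generate.one one_presented_group)
  next
    case (Cons y w)
    obtain x b where y: "y = (x, b)"
      by (cases y)
    have "word_class (y # w) = word_class [y] \<otimes>\<^bsub>?G\<^esub> word_class w"
      using Cons.prems by (subst mult_word_class) auto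
    with Cons letter show ?case
      by (auto simp: y intro: generate.eng)
  qed
  then show "carrier ?G \<subseteq> generate ?G ?X"
    by (auto simp: carrier_presented_group)
qed

end

text \<open>Words are read from left to right, so this is a right action of the presented group.\<close>

locale presentation_action = group_presentation S R
  for S :: "'a set" and R +
  fixes act :: "'a \<times> bool \<Rightarrow> 's \<Rightarrow> 's" and \<Omega> :: "'s set"
  assumes act_closed: "\<And>x b s. x \<in> S \<Longrightarrow> s \<in> \<Omega> \<Longrightarrow> act (x, b) s \<in> \<Omega>"
    and act_cancel: "\<And>x b s. x \<in> S \<Longrightarrow> s \<in> \<Omega> \<Longrightarrow> act (x, \<not> b) (act (x, b) s) = s"
    and act_rel: "\<And>u v s. (u, v) \<in> R \<Longrightarrow> s \<in> \<Omega> \<Longrightarrow> fold act u s = fold act v s"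
begin

lemma fold_act_closed: "w \<in> gwords S \<Longrightarrow> s \<in> \<Omega> \<Longrightarrow> fold act w s \<in> \<Omega>"
  by (induction w arbitrary: s) (auto simp: act_closed)

text \<open>Induction on the congruence. For \<open>append\<close>, invariance of
  \<open>\<Omega>\<close> ensures that the second word starts from an admissible state.\<close>

lemma fold_act_cong: "(u, v) \<in> pres_cong S R \<Longrightarrow> s \<in> \<Omega> \<Longrightarrow> fold act u s = fold act v s"
proof (induction arbitrary: s rule: pres_cong.induct)
  case (append u u' v v')
  then have "fold act u s \<in> \<Omega>"
    using fold_act_closed pres_cong_gwords by blast
  with append show ?case
    by simp
qed (use pres_cong_gwords in \<open>auto simp: act_cancel act_rel\<close>)

text \<open>The chosen representative is immaterial on \<open>\<Omega>\<close> by
  \<open>fold_act_cong\<close>. Suitable actions yield both normal forms and characters.\<close>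

definition orbit_map :: "'s \<Rightarrow> 'a gword set \<Rightarrow> 's" where
  "orbit_map s g = fold act (SOME w. w \<in> g) s"

lemma orbit_map_word_class:
  assumes "w \<in> gwords S" "s \<in> \<Omega>"
  shows "orbit_map s (word_class w) = fold act w s"
proof -
  have "(SOME u. u \<in> word_class w) \<in> word_class w"
    by (rule someI[of _ w]) (use assms in \<open>auto intro: pres_cong.refl\<close>)
  then show ?thesis
    unfolding orbit_map_def using assms fold_act_cong[of w] by fastforce
qed

end

section \<open>Normal forms in a free product of two copies of the reals\<close>

text \<open>An element is stored as the list of its syllables, the last one first; the boolean says which
  factor a syllable belongs to.\<close>

fun push_syllable :: "bool \<Rightarrow> real \<Rightarrow> (bool \<times> real) list \<Rightarrow> (bool \<times> real) list" where
  "push_syllable i r [] = (if r = 0 then [] else [(i, r)])"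
| "push_syllable i r ((j, q) # s) =
     (if r = 0 then (j, q) # s
      else if i = j then (if q + r = 0 then s else (i, q + r) # s)
      else (i, r) # (j, q) # s)"

fun reduced :: "(bool \<times> real) list \<Rightarrow> bool" where
  "reduced [] \<longleftrightarrow> True"
| "reduced [(i, r)] \<longleftrightarrow> r \<noteq> 0"
| "reduced ((i, r) # (j, q) # s) \<longleftrightarrow> r \<noteq> 0 \<and> i \<noteq> j \<and> reduced ((j, q) # s)"

lemma reduced_push_syllable: "reduced s \<Longrightarrow> reduced (push_syllable i r s)"
  by (cases s rule: reduced.cases) auto

text \<open>Each factor acts as the additive group of the reals. Reducedness matters when the first
  push cancels the head: the syllable then exposed belongs to the other factor, so the second push
  does not merge with it.\<close>

lemma push_syllable_push_syllable:
  "reduced s \<Longrightarrow> push_syllable i r (push_syllable i q s) = push_syllable i (q + r) s"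
  by (cases s rule: reduced.cases) (auto simp: add.assoc)

lemma push_syllable_zero [simp]: "push_syllable i 0 s = s"
  by (cases "(i, 0 :: real, s)" rule: push_syllable.cases) auto

text \<open>The homomorphism from the free product to the reals that multiplies by
  \<open>wt i\<close> on factor \<open>i\<close>, read off a normal form.\<close>

definition syllable_sum :: "(bool \<Rightarrow> real) \<Rightarrow> (bool \<times> real) list \<Rightarrow> real" where
  "syllable_sum wt s = (\<Sum>(i, r)\<leftarrow>s. wt i * r)"

lemma syllable_sum_push:
  "syllable_sum wt (push_syllable i r s) = syllable_sum wt s + wt i * r"
proof (cases s)
  case (Cons p s')
  obtain j q where p: "p = (j, q)"
    by (cases p)
  show ?thesis
  proof (cases "i = j \<and> q + r = 0")
    case True
    then have "q = - r"
      by simp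
    with True show ?thesis
      by (auto simp: syllable_sum_def Cons p)
  qed (auto simp: syllable_sum_def Cons p algebra_simps)
qed (auto simp: syllable_sum_def)

text \<open>As the last syllable is stored first, this says that the normal form begins with
  \<open>p\<close> and has at least one more syllable.\<close>

definition properly_starts :: "bool \<times> real \<Rightarrow> (bool \<times> real) list \<Rightarrow> bool" where
  "properly_starts p s \<longleftrightarrow> (\<exists>q s'. s = s' @ [q, p])"

text \<open>Only the head of the list changes. So \<open>p\<close>, at the far end, is left alone
  unless it had a single successor and that cancels, which leaves \<open>[p]\<close>.\<close>

lemma properly_starts_push:
  assumes "properly_starts p s"
  shows "properly_starts p (push_syllable i r s) \<or> push_syllable i r s = [p]"
proof -
  obtain q s' where s: "s = s' @ [q, p]"
    using assms by (auto simp: properly_starts_def)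
  have extend: "properly_starts p (u @ [q, p])" for u
    by (auto simp: properly_starts_def)
  show ?thesis
  proof (cases s')
    case Nil
    then show ?thesis
      using extend[of "[]"] extend[of "[(i, r)]"]
      by (cases q) (auto simp: s properly_starts_def)
  next
    case (Cons e s'')
    then show ?thesis
      using extend[of s'] extend[of s''] extend[of "(i, r) # s'"] extend[of "(i, snd e + r) # s''"]
      by (cases e) (auto simp: s)
  qed
qed


section \<open>Graph groups\<close>

lemma (in group) commutes_inv:
  assumes "x \<in> carrier G" "y \<in> carrier G" "x \<otimes> y = y \<otimes> x"
  shows "inv x \<otimes> y = y \<otimes> inv x"
  using assms by (metis inv_closed inv_solve_left inv_solve_right m_assoc m_closed)

locale simplicial_graph = pair_graph \<G> for \<G> :: "'a pair_pre_digraph"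
begin

sublocale group_presentation "pverts \<G>" "commutation_relations \<G>"
  by unfold_locales (auto simp: commutation_relations_def gwords_def dest: in_arcsD1 in_arcsD2)

abbreviation GG :: "'a gword set monoid" where
  "GG \<equiv> graph_group \<G>"

abbreviation gens :: "'a gword set set" where
  "gens \<equiv> standard_generator \<G> ` pverts \<G>"

sublocale GG: group GG
  unfolding graph_group_def by (rule group_presented_group)

lemma standard_generator_eq: "standard_generator \<G> v = word_class [(v, True)]"
  by (simp add: standard_generator_def)

lemma carrier_GG: "carrier GG = word_class ` gwords (pverts \<G>)"
  by (simp add: graph_group_def carrier_presented_group)

lemma carrier_GG_E:
  assumes "g \<in> carrier GG"
  obtains w where "w \<in> gwords (pverts \<G>)" "g = word_class w"
  using assms unfolding carrier_GG by (auto elim!: imageE)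

lemma one_GG: "\<one>\<^bsub>GG\<^esub> = word_class []"
  by (simp add: graph_group_def one_presented_group)

lemma mult_GG:
  "u \<in> gwords (pverts \<G>) \<Longrightarrow> v \<in> gwords (pverts \<G>) \<Longrightarrow>
    word_class u \<otimes>\<^bsub>GG\<^esub> word_class v = word_class (u @ v)"
  by (simp add: graph_group_def mult_word_class)

lemma inv_letter: "v \<in> pverts \<G> \<Longrightarrow> inv\<^bsub>GG\<^esub> word_class [(v, b)] = word_class [(v, \<not> b)]"
  by (simp add: graph_group_def inv_word_class_letter)

lemma letter_in_carrier: "v \<in> pverts \<G> \<Longrightarrow> word_class [(v, b)] \<in> carrier GG"
  by (simp add: carrier_GG)

lemma gens_subset: "gens \<subseteq> carrier GG"
  by (auto simp: standard_generator_eq letter_in_carrier)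

lemma generate_gens: "generate GG gens = carrier GG"
  using generate_presented_group by (simp add: graph_group_def standard_generator_eq)

lemma finite_gens: "finite gens"
  using pair_finite_verts by simp

lemma parcs_sym: "(v, w) \<in> parcs \<G> \<Longrightarrow> (w, v) \<in> parcs \<G>"
  using pair_sym_arcs by (auto simp: symmetric_def sym_def)

text \<open>The defining relation covers two positive letters; the other sign patterns follow by
  inverting first one letter, then the other.\<close>

lemma letter_commute:
  assumes "(v, w) \<in> parcs \<G>"
  shows "word_class [(v, b)] \<otimes>\<^bsub>GG\<^esub> word_class [(w, c)] = word_class [(w, c)] \<otimes>\<^bsub>GG\<^esub> word_class [(v, b)]"
proof -
  have v: "v \<in> pverts \<G>" and w: "w \<in> pverts \<G>"
    using assms by (auto dest: in_arcsD1 in_arcsD2)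
  have "([(v, True), (w, True)], [(w, True), (v, True)])
      \<in> pres_cong (pverts \<G>) (commutation_relations \<G>)"
    using assms by (intro pres_cong.rel) (auto simp: commutation_relations_def)
  then have base: "word_class [(v, True)] \<otimes>\<^bsub>GG\<^esub> word_class [(w, True)] =
      word_class [(w, True)] \<otimes>\<^bsub>GG\<^esub> word_class [(v, True)]"
    using v w by (simp add: mult_GG word_class_eq_iff)
  have inv_false: "word_class [(x, False)] = inv\<^bsub>GG\<^esub> word_class [(x, True)]" if "x \<in> pverts \<G>" for x
    using inv_letter[OF that, of True] by simp
  have half: "word_class [(v, b)] \<otimes>\<^bsub>GG\<^esub> word_class [(w, True)] =
      word_class [(w, True)] \<otimes>\<^bsub>GG\<^esub> word_class [(v, b)]"
    using base v w by (cases b) (simp_all add: inv_false GG.commutes_inv letter_in_carrier)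
  show ?thesis
  proof (cases c)
    case False
    then show ?thesis
      using GG.commutes_inv[OF letter_in_carrier[OF w] letter_in_carrier[OF v] half[symmetric]]
      by (simp add: inv_false[OF w])
  qed (use half in simp)
qed

text \<open>The arcs of \<open>\<G>\<close> are already symmetric, so \<open>mk_symmetric\<close>
  adds none.\<close>

lemma connected_living_subgraph_iff:
  assumes "A \<subseteq> pverts \<G>"
  shows "Digraph_Component.connected (living_subgraph \<G> A) \<longleftrightarrow>
    A \<noteq> {} \<and> (\<forall>u\<in>A. \<forall>v\<in>A. (u, v) \<in> (parcs \<G> \<inter> A \<times> A)\<^sup>*)"
proof -
  have "wf_digraph (living_subgraph \<G> A)"
    by unfold_locales (auto simp: living_subgraph_def)
  moreover have "parcs (mk_symmetric (living_subgraph \<G> A)) = parcs \<G> \<inter> A \<times> A"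
  proof
    show "parcs (mk_symmetric (living_subgraph \<G> A)) \<subseteq> parcs \<G> \<inter> A \<times> A"
      by (auto simp: parcs_mk_symmetric living_subgraph_def intro: parcs_sym)
    show "parcs \<G> \<inter> A \<times> A \<subseteq> parcs (mk_symmetric (living_subgraph \<G> A))"
      by (force simp: parcs_mk_symmetric living_subgraph_def)
  qed
  ultimately show ?thesis
    by (simp add: connected_iff_rtrancl) (simp add: living_subgraph_def)
qed

lemma dominating_living_subgraph_iff:
  "dominating (living_subgraph \<G> A) (with_proj \<G>) \<longleftrightarrow>
    (\<forall>v\<in>pverts \<G> - A. \<exists>w\<in>A. (v, w) \<in> parcs \<G>)"
  by (simp add: dominating_def living_subgraph_def)

end


section \<open>Characters of graph groups: connected dominating living subgraphs\<close>

locale graph_character = simplicial_graph +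
  fixes \<chi> :: "'a gword set \<Rightarrow> real"
  assumes character: "\<chi> \<in> characters (graph_group \<G>)"
begin

sublocale height_group GG \<chi>
  by unfold_locales (use character in \<open>auto simp: characters_def hom_def real_group_def\<close>)

lemma character_nonzero: "\<exists>g\<in>carrier GG. \<chi> g \<noteq> 0"
  using character by (simp add: characters_def)

definition living :: "'a set" where
  "living = {v \<in> pverts \<G>. \<chi> (standard_generator \<G> v) \<noteq> 0}"

text \<open>The one of \<open>v\<close> and \<open>v\<^sup>-\<^sup>1\<close> that has positive height if \<open>v\<close> is living.\<close>

definition pos_letter :: "'a \<Rightarrow> 'a gword set" where
  "pos_letter v = word_class [(v, \<chi> (standard_generator \<G> v) > 0)]"

lemma height_letter:
  "v \<in> pverts \<G> \<Longrightarrow> \<chi> (word_class [(v, b)]) =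
    (if b then \<chi> (standard_generator \<G> v) else - \<chi> (standard_generator \<G> v))"
  using height_inv[of "word_class [(v, True)]"] inv_letter[of v True]
  by (auto simp: standard_generator_eq letter_in_carrier)

lemma living_nonempty: "living \<noteq> {}"
  using exists_generator_nonzero_height[OF gens_subset generate_gens character_nonzero]
  by (auto simp: living_def)

lemma pos_letter:
  assumes "v \<in> living"
  shows "pos_letter v \<in> carrier GG" "\<chi> (pos_letter v) > 0"
    "(\<one>\<^bsub>GG\<^esub>, pos_letter v) \<in> above_path gens 0"
proof -
  have v: "v \<in> pverts \<G>" "\<chi> (standard_generator \<G> v) \<noteq> 0"
    using assms by (auto simp: living_def)
  show "pos_letter v \<in> carrier GG" "\<chi> (pos_letter v) > 0"
    using v by (auto simp: pos_letter_def letter_in_carrier height_letter)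
  have gen: "standard_generator \<G> v \<in> gens"
    using v by simp
  show "(\<one>\<^bsub>GG\<^esub>, pos_letter v) \<in> above_path gens 0"
  proof (cases "\<chi> (standard_generator \<G> v) > 0")
    case True
    then show ?thesis
      using above_path_generator(1)[OF gen gens_subset]
      by (auto simp: pos_letter_def standard_generator_eq)
  next
    case False
    then have "pos_letter v = inv\<^bsub>GG\<^esub> standard_generator \<G> v"
      using v by (simp add: pos_letter_def standard_generator_eq inv_letter)
    then show ?thesis
      using above_path_generator(2)[OF gen gens_subset] False by (auto simp: min_def)
  qed
qed

text \<open>Induction along the path in the living subgraph, each edge being one exchange of
  commuting powers. The height bound in the conclusion keeps the later exchanges above the initial
  level.\<close>

lemma above_path_living:
  fixes N :: nat
  assumes "(a, b) \<in> (parcs \<G> \<inter> living \<times> living)\<^sup>*" "a \<in> living"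
  shows "\<exists>M::nat. (pos_letter a [^]\<^bsub>GG\<^esub> N, pos_letter b [^]\<^bsub>GG\<^esub> M)
      \<in> above_path gens (N * \<chi> (pos_letter a)) \<and> N * \<chi> (pos_letter a) \<le> M * \<chi> (pos_letter b)"
  using assms(1)
proof (induction rule: rtrancl_induct)
  case (step b c)
  then obtain M :: nat where M:
    "(pos_letter a [^]\<^bsub>GG\<^esub> N, pos_letter b [^]\<^bsub>GG\<^esub> M) \<in> above_path gens (N * \<chi> (pos_letter a))"
    "N * \<chi> (pos_letter a) \<le> M * \<chi> (pos_letter b)"
    by blast
  have bc: "b \<in> living" "c \<in> living" "(b, c) \<in> parcs \<G>"
    using step by auto
  have "pos_letter b \<otimes>\<^bsub>GG\<^esub> pos_letter c = pos_letter c \<otimes>\<^bsub>GG\<^esub> pos_letter b"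
    unfolding pos_letter_def using bc by (intro letter_commute)
  then obtain M' :: nat where M':
    "(pos_letter b [^]\<^bsub>GG\<^esub> M, pos_letter c [^]\<^bsub>GG\<^esub> M') \<in> above_path gens (M * \<chi> (pos_letter b))"
    "M * \<chi> (pos_letter b) \<le> M' * \<chi> (pos_letter c)"
    using above_path_commuting_powers[OF gens_subset pos_letter[OF bc(1)] pos_letter[OF bc(2)]]
    by blast
  have "(pos_letter a [^]\<^bsub>GG\<^esub> N, pos_letter c [^]\<^bsub>GG\<^esub> M') \<in> above_path gens (N * \<chi> (pos_letter a))"
    using rtrancl_trans[OF M(1) above_path_mono[OF M'(1) M(2)]] .
  with M(2) M'(2) show ?case
    by (meson order_trans)
qed (auto intro!: exI[of _ N])

text \<open>The loss \<open>\<bar>\<chi> x\<bar>\<close> pays for the edge labelled \<open>x\<close>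
  and for the return path, which is translated by \<open>x\<close>.\<close>

lemma above_path_conjugate_generator:
  fixes N :: nat
  assumes conn: "\<And>u v. u \<in> living \<Longrightarrow> v \<in> living \<Longrightarrow> (u, v) \<in> (parcs \<G> \<inter> living \<times> living)\<^sup>*"
    and dom: "\<And>v. v \<in> pverts \<G> - living \<Longrightarrow> \<exists>w\<in>living. (v, w) \<in> parcs \<G>"
    and a: "a \<in> living" and x: "x \<in> gens"
  shows "(pos_letter a [^]\<^bsub>GG\<^esub> N, x \<otimes>\<^bsub>GG\<^esub> pos_letter a [^]\<^bsub>GG\<^esub> N)
    \<in> above_path gens (N * \<chi> (pos_letter a) - \<bar>\<chi> x\<bar>)"
proof -
  let ?t = "pos_letter a"
  obtain v where v: "v \<in> pverts \<G>" "x = word_class [(v, True)]"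
    using x by (auto simp: standard_generator_eq)
  have xc: "x \<in> carrier GG"
    using v letter_in_carrier by simp
  \<comment> \<open>A living vertex commuting with \<open>x\<close>: the vertex of \<open>x\<close>
    itself if it is living, otherwise a living neighbour supplied by domination.\<close>
  have "\<exists>b\<in>living. pos_letter b \<otimes>\<^bsub>GG\<^esub> x = x \<otimes>\<^bsub>GG\<^esub> pos_letter b"
  proof (cases "v \<in> living")
    case True
    have "pos_letter v = x \<or> pos_letter v = inv\<^bsub>GG\<^esub> x"
      using v inv_letter[of v True]
      by (cases "\<chi> (standard_generator \<G> v) > 0") (simp_all add: pos_letter_def)
    then have "pos_letter v \<otimes>\<^bsub>GG\<^esub> x = x \<otimes>\<^bsub>GG\<^esub> pos_letter v"
      using xc by auto
    with True show ?thesis ..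
  next
    case False
    then obtain w where "w \<in> living" "(w, v) \<in> parcs \<G>"
      using dom v parcs_sym by blast
    then show ?thesis
      unfolding v(2) pos_letter_def by (intro bexI[of _ w] letter_commute)
  qed
  then obtain b where b: "b \<in> living" "pos_letter b \<otimes>\<^bsub>GG\<^esub> x = x \<otimes>\<^bsub>GG\<^esub> pos_letter b"
    by blast
  let ?s = "pos_letter b"
  obtain M :: nat where M: "(?t [^]\<^bsub>GG\<^esub> N, ?s [^]\<^bsub>GG\<^esub> M) \<in> above_path gens (N * \<chi> ?t)"
    "N * \<chi> ?t \<le> M * \<chi> ?s"
    using above_path_living[OF conn[OF a b(1)] a] by blast
  have tc: "?t [^]\<^bsub>GG\<^esub> N \<in> carrier GG" and sc: "?s [^]\<^bsub>GG\<^esub> M \<in> carrier GG"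
    using pos_letter a b by auto
  let ?c = "N * \<chi> ?t - \<bar>\<chi> x\<bar>"
  have "(?t [^]\<^bsub>GG\<^esub> N, ?s [^]\<^bsub>GG\<^esub> M) \<in> above_path gens ?c"
    using M(1) by (rule above_path_mono) simp
  \<comment> \<open>By commutation, left multiplication by \<open>x\<close> is here a right
    multiplication and thus a single edge.\<close>
  moreover have "(?s [^]\<^bsub>GG\<^esub> M, x \<otimes>\<^bsub>GG\<^esub> ?s [^]\<^bsub>GG\<^esub> M) \<in> above_adj gens ?c"
  proof -
    have "?s [^]\<^bsub>GG\<^esub> M \<otimes>\<^bsub>GG\<^esub> x = x \<otimes>\<^bsub>GG\<^esub> ?s [^]\<^bsub>GG\<^esub> M"
      using b pos_letter xc by (intro GG.group_commutes_pow) auto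
    then show ?thesis
      using x xc sc M(2) pos_letter(1)[OF b(1)] by (auto simp: above_adj_def height_mult)
  qed
  \<comment> \<open>The way back is the \<open>x\<close>-translate of the way out, reversed.\<close>
  moreover have "(x \<otimes>\<^bsub>GG\<^esub> ?t [^]\<^bsub>GG\<^esub> N, x \<otimes>\<^bsub>GG\<^esub> ?s [^]\<^bsub>GG\<^esub> M) \<in> above_path gens ?c"
    using above_path_translate[OF M(1) xc gens_subset] by (rule above_path_mono) simp
  then have "(x \<otimes>\<^bsub>GG\<^esub> ?s [^]\<^bsub>GG\<^esub> M, x \<otimes>\<^bsub>GG\<^esub> ?t [^]\<^bsub>GG\<^esub> N) \<in> above_path gens ?c"
    by (rule above_path_sym)
  ultimately show ?thesis
    by (meson rtrancl_into_rtrancl rtrancl_trans)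
qed

text \<open>Right multiplication by \<open>s\<close> does not map edges to edges, but
  \<open>above_path_conjugate_generator\<close> turns the image of each edge into a path. Thus a
  whole path from \<open>\<one>\<close> to \<open>g\<close> is lifted.\<close>

lemma half_connected_if_connected_dominating:
  assumes conn: "\<And>u v. u \<in> living \<Longrightarrow> v \<in> living \<Longrightarrow> (u, v) \<in> (parcs \<G> \<inter> living \<times> living)\<^sup>*"
    and dom: "\<And>v. v \<in> pverts \<G> - living \<Longrightarrow> \<exists>w\<in>living. (v, w) \<in> parcs \<G>"
  shows "half_connected gens"
  unfolding half_connected_def
proof (intro ballI impI)
  fix g assume g: "g \<in> carrier GG" "\<chi> g \<ge> 0"
  obtain a where a: "a \<in> living"
    using living_nonempty by blast
  obtain c where c: "(\<one>\<^bsub>GG\<^esub>, g) \<in> above_path gens c"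
    using above_path_exists[OF gens_subset] g generate_gens by blast
  define K where "K = (\<Sum>x\<in>gens. \<bar>\<chi> x\<bar>)"
  have K: "\<bar>\<chi> x\<bar> \<le> K" if "x \<in> gens" for x
    unfolding K_def using that finite_gens by (intro member_le_sum) auto
  \<comment> \<open>Even at the lowest level \<open>c\<close> of the path, and after the largest
    loss \<open>K\<close> for a generator, the lifted path stays above 0.\<close>
  obtain N :: nat where N: "K - c < N * \<chi> (pos_letter a)"
    using ex_less_of_nat_mult[OF pos_letter(2)[OF a]] by blast
  define s where "s = pos_letter a [^]\<^bsub>GG\<^esub> N"
  have s: "s \<in> carrier GG" "\<chi> s = N * \<chi> (pos_letter a)"
    using pos_letter[OF a] by (auto simp: s_def)
  have edge: "(h \<otimes>\<^bsub>GG\<^esub> s, h \<otimes>\<^bsub>GG\<^esub> x \<otimes>\<^bsub>GG\<^esub> s) \<in> above_path gens 0"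
    if "h \<in> carrier GG" "\<chi> h \<ge> c" "x \<in> gens" for h x
  proof -
    have xc: "x \<in> carrier GG"
      using that gens_subset by blast
    have "(s, x \<otimes>\<^bsub>GG\<^esub> s) \<in> above_path gens (\<chi> s - \<bar>\<chi> x\<bar>)"
      using above_path_conjugate_generator[OF conn dom a that(3), of N] s by (simp add: s_def)
    then have "(h \<otimes>\<^bsub>GG\<^esub> s, h \<otimes>\<^bsub>GG\<^esub> (x \<otimes>\<^bsub>GG\<^esub> s)) \<in> above_path gens (\<chi> h + (\<chi> s - \<bar>\<chi> x\<bar>))"
      using that(1) gens_subset by (rule above_path_translate)
    then have "(h \<otimes>\<^bsub>GG\<^esub> s, h \<otimes>\<^bsub>GG\<^esub> (x \<otimes>\<^bsub>GG\<^esub> s)) \<in> above_path gens 0"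
      by (rule above_path_mono) (use K[OF that(3)] N s that(2) in simp)
    then show ?thesis
      using that(1) xc s by (simp add: GG.m_assoc)
  qed
  have "(s, g \<otimes>\<^bsub>GG\<^esub> s) \<in> above_path gens 0"
    using c
  proof (induction rule: rtrancl_induct)
    case base
    then show ?case
      using s by simp
  next
    case (step h h')
    then have h: "h \<in> carrier GG" "\<chi> h \<ge> c" "h' \<in> carrier GG" "\<chi> h' \<ge> c"
      by (simp_all add: above_adj_def)
    obtain x where "x \<in> gens" "h' = h \<otimes>\<^bsub>GG\<^esub> x \<or> h = h' \<otimes>\<^bsub>GG\<^esub> x"
      using step.hyps(2) unfolding above_adj_def by blast
    then have "(h \<otimes>\<^bsub>GG\<^esub> s, h' \<otimes>\<^bsub>GG\<^esub> s) \<in> above_path gens 0"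
      using edge h above_path_sym by metis
    with step.IH show ?case
      by (rule rtrancl_trans)
  qed
  moreover have "(\<one>\<^bsub>GG\<^esub>, s) \<in> above_path gens 0"
    unfolding s_def using pos_letter[OF a] gens_subset by (intro above_path_pow) auto
  moreover have "(g, g \<otimes>\<^bsub>GG\<^esub> s) \<in> above_path gens (\<chi> g)"
    unfolding s_def using pos_letter[OF a] gens_subset g by (intro above_path_mult_pow) auto
  then have "(g \<otimes>\<^bsub>GG\<^esub> s, g) \<in> above_path gens 0"
    using g by (meson above_path_mono above_path_sym)
  ultimately show "(\<one>\<^bsub>GG\<^esub>, g) \<in> above_path gens 0"
    by (meson rtrancl_trans)
qed

end

section \<open>Disconnected half spaces from splittings, and the criterion for one character\<close>

context graph_character
begin

text \<open>Suppose \<open>\<chi>\<close> factors through a map of the graph group to the free product of two copies of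
  the reals. In the Cayley graph of the free product, the elements whose normal form begins with the
  syllable of \<open>a\<^sup>-\<^sup>1\<close> and has further syllables can only be reached through \<open>a\<^sup>-\<^sup>1\<close>,
  which has negative height.\<close>

lemma not_half_connected_if_splits:
  fixes side :: "'a \<Rightarrow> bool" and val :: "'a \<Rightarrow> real" and wt :: "bool \<Rightarrow> real"
  assumes splits: "\<And>x y. (x, y) \<in> parcs \<G> \<Longrightarrow> val x = 0 \<or> val y = 0 \<or> side x = side y"
    and height: "\<And>v. v \<in> pverts \<G> \<Longrightarrow> \<chi> (standard_generator \<G> v) = wt (side v) * val v"
    and a: "a \<in> living" "\<not> side a"
    and b: "b \<in> pverts \<G>" "side b" "val b \<noteq> 0"
  shows "\<not> half_connected gens"
proof
  assume conn: "half_connected gens"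
  define lval where "lval = (\<lambda>(v, c). if c then val v else - val v)"
  define act where "act = (\<lambda>l. push_syllable (side (fst l)) (lval l))"
  interpret presentation_action "pverts \<G>" "commutation_relations \<G>" act "Collect reduced"
  proof unfold_locales
    show "act (x, c) s \<in> Collect reduced" if "s \<in> Collect reduced" for x c s
      using that by (simp add: act_def reduced_push_syllable)
    show "act (x, \<not> c) (act (x, c) s) = s" if "s \<in> Collect reduced" for x c s
      using that by (simp add: act_def lval_def push_syllable_push_syllable)
    show "fold act u s = fold act v s"
      if uv: "(u, v) \<in> commutation_relations \<G>" and s: "s \<in> Collect reduced" for u v s
    proof -
      obtain x y where xy: "u = [(x, True), (y, True)]" "v = [(y, True), (x, True)]" "(x, y) \<in> parcs \<G>"
        using uv unfolding commutation_relations_def by blast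
      \<comment> \<open>A letter of value 0 acts trivially, and two letters on the same side add to
        the same abelian factor.\<close>
      consider "val x = 0" | "val y = 0" | "side x = side y"
        using splits[OF xy(3)] by blast
      then show ?thesis
        using s
        by cases (simp_all add: xy act_def lval_def push_syllable_push_syllable add.commute)
    qed
  qed
  define nf where "nf = orbit_map []"
  have nf_word: "nf (word_class w) = fold act w []" if "w \<in> gwords (pverts \<G>)" for w
    using that by (simp add: nf_def orbit_map_word_class)
  have nf_reduced: "reduced (nf g)" if g: "g \<in> carrier GG" for g
  proof -
    obtain w where "w \<in> gwords (pverts \<G>)" "g = word_class w"
      using g by (rule carrier_GG_E)
    then show ?thesis
      using fold_act_closed[of w "[]"] by (simp add: nf_word)
  qed
  have nf_letter: "nf (g \<otimes>\<^bsub>GG\<^esub> word_class [(v, c)]) = push_syllable (side v) (lval (v, c)) (nf g)"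
    if g: "g \<in> carrier GG" and v: "v \<in> pverts \<G>" for g v c
  proof -
    obtain w where w: "w \<in> gwords (pverts \<G>)" "g = word_class w"
      using g by (rule carrier_GG_E)
    have "nf (word_class (w @ [(v, c)])) = push_syllable (side v) (lval (v, c)) (fold act w [])"
      using w(1) v by (subst nf_word) (simp_all add: act_def)
    then show ?thesis
      using w v by (simp add: mult_GG nf_word)
  qed
  have height_lval: "\<chi> (word_class [(v, c)]) = wt (side v) * lval (v, c)" if "v \<in> pverts \<G>" for v c
    using that by (simp add: height_letter height lval_def)
  have height_nf: "\<chi> g = syllable_sum wt (nf g)" if g: "g \<in> carrier GG" for g
  proof -
    have "\<chi> (word_class w) = syllable_sum wt (fold act w [])" if "w \<in> gwords (pverts \<G>)" for w
      using that
    proof (induction w rule: rev_induct)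
      case Nil
      then show ?case
        using height_one by (simp add: one_GG syllable_sum_def)
    next
      case (snoc l w)
      obtain v c where l: "l = (v, c)"
        by (cases l)
      have vw: "v \<in> pverts \<G>" "w \<in> gwords (pverts \<G>)"
        using snoc.prems l by auto
      have "\<chi> (word_class (w @ [l])) = \<chi> (word_class w \<otimes>\<^bsub>GG\<^esub> word_class [l])"
        using snoc.prems by (simp add: mult_GG)
      also have "\<dots> = \<chi> (word_class w) + \<chi> (word_class [l])"
        using vw l by (intro height_mult) (simp_all add: carrier_GG)
      also have "\<dots> = syllable_sum wt (fold act (w @ [l]) [])"
        using snoc.IH[OF vw(2)] vw(1) by (simp add: l height_lval act_def syllable_sum_push)
      finally show ?case .
    qed
    moreover obtain w where "w \<in> gwords (pverts \<G>)" "g = word_class w"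
      using g by (rule carrier_GG_E)
    ultimately show ?thesis
      by (simp add: nf_word)
  qed

  \<comment> \<open>\<open>(a, \<beta>)\<close> is the letter of positive height among
    \<open>a\<close> and its inverse, \<open>r\<close> its value in the factor \<open>False\<close>,
    and \<open>p\<close> the syllable of its inverse, of negative height.\<close>
  define \<beta> where "\<beta> \<longleftrightarrow> \<chi> (standard_generator \<G> a) > 0"
  define r where "r = lval (a, \<beta>)"
  define p where "p = (False, - r)"
  have aV: "a \<in> pverts \<G>"
    using a by (simp add: living_def)
  have t: "pos_letter a = word_class [(a, \<beta>)]"
    by (simp add: pos_letter_def \<beta>_def)
  have r: "wt False * r > 0"
    using pos_letter(2)[OF a(1)] height_lval[OF aV, of \<beta>] a(2) by (simp add: t r_def)
  have step: "properly_starts p (nf h)"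
    if adj: "(g, h) \<in> above_adj gens 0" and starts: "properly_starts p (nf g)" for g h
  proof -
    have gh: "g \<in> carrier GG" "h \<in> carrier GG" "\<chi> h \<ge> 0"
      using adj by (simp_all add: above_adj_def)
    obtain v where v: "v \<in> pverts \<G>"
      "h = g \<otimes>\<^bsub>GG\<^esub> word_class [(v, True)] \<or> g = h \<otimes>\<^bsub>GG\<^esub> word_class [(v, True)]"
      using adj unfolding above_adj_def standard_generator_eq by blast
    \<comment> \<open>This closes the only exit left by \<open>properly_starts_push\<close>: an
      element with normal form \<open>[p]\<close> lies below height 0.\<close>
    have "nf h \<noteq> [p]"
      using height_nf[OF gh(2)] gh(3) r by (auto simp: p_def syllable_sum_def)
    moreover have "\<exists>i q. nf h = push_syllable i q (nf g)"
      using v(2)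
    proof
      assume "h = g \<otimes>\<^bsub>GG\<^esub> word_class [(v, True)]"
      then show ?thesis
        using nf_letter[OF gh(1) v(1)] by blast
    next
      assume "g = h \<otimes>\<^bsub>GG\<^esub> word_class [(v, True)]"
      then have "nf h = push_syllable (side v) (- lval (v, True)) (nf g)"
        using nf_letter[OF gh(2) v(1), of True] nf_reduced[OF gh(2)]
        by (simp add: push_syllable_push_syllable)
      then show ?thesis
        by blast
    qed
    ultimately show ?thesis
      using properly_starts_push[OF starts] by metis
  qed
  have path: "properly_starts p (nf h)"
    if "(g, h) \<in> above_path gens 0" "properly_starts p (nf g)" for g h
    using that by (induction rule: rtrancl_induct) (auto dest: step)

  \<comment> \<open>The normal form of \<open>g\<close> is \<open>p\<close> followed by a non-zero
    syllable of the other factor. The height of \<open>g\<close> may be negative, so a power of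
    \<open>pos_letter a\<close> is appended later; the syllable of \<open>b\<close> shields
    \<open>p\<close> from it.\<close>
  define g where "g = word_class [(a, \<not> \<beta>)] \<otimes>\<^bsub>GG\<^esub> word_class [(b, True)]"
  have g: "g \<in> carrier GG"
    using aV b by (simp add: g_def letter_in_carrier)
  have "nf (word_class [(a, \<not> \<beta>)]) = [p]"
    using aV a(2) r by (auto simp: nf_word act_def p_def r_def lval_def)
  then have nf_g: "nf g = [(True, val b), p]"
    using nf_letter[OF letter_in_carrier[OF aV] b(1), of "\<not> \<beta>" True] b
    by (simp add: g_def p_def lval_def)
  have tc: "pos_letter a \<in> carrier GG"
    using pos_letter a by blast
  have nf_pow: "nf (g \<otimes>\<^bsub>GG\<^esub> pos_letter a [^]\<^bsub>GG\<^esub> n) = push_syllable False (n * r) (nf g)" for n :: nat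
  proof (induction n)
    case 0
    then show ?case
      using g by simp
  next
    case (Suc n)
    have "g \<otimes>\<^bsub>GG\<^esub> pos_letter a [^]\<^bsub>GG\<^esub> Suc n
        = (g \<otimes>\<^bsub>GG\<^esub> pos_letter a [^]\<^bsub>GG\<^esub> n) \<otimes>\<^bsub>GG\<^esub> word_class [(a, \<beta>)]"
      using g tc by (simp add: GG.m_assoc flip: t)
    then have "nf (g \<otimes>\<^bsub>GG\<^esub> pos_letter a [^]\<^bsub>GG\<^esub> Suc n)
        = push_syllable False r (push_syllable False (n * r) (nf g))"
      using nf_letter[of "g \<otimes>\<^bsub>GG\<^esub> pos_letter a [^]\<^bsub>GG\<^esub> n" a \<beta>] g tc aV a(2) Suc
      by (simp add: r_def)
    then show ?case
      using nf_reduced[OF g] by (simp add: push_syllable_push_syllable algebra_simps)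
  qed
  obtain n :: nat where n: "- \<chi> g < n * \<chi> (pos_letter a)"
    using ex_less_of_nat_mult[OF pos_letter(2)[OF a(1)]] by blast
  let ?h = "g \<otimes>\<^bsub>GG\<^esub> pos_letter a [^]\<^bsub>GG\<^esub> n"
  have "?h \<in> carrier GG" "\<chi> ?h \<ge> 0"
    using g tc n by (simp_all add: height_mult)
  then have "(\<one>\<^bsub>GG\<^esub>, ?h) \<in> above_path gens 0"
    using conn by (simp add: half_connected_def)
  moreover have "properly_starts p (nf ?h)"
    by (auto simp: nf_pow nf_g properly_starts_def)
  ultimately have "properly_starts p (nf \<one>\<^bsub>GG\<^esub>)"
    using path above_path_sym by blast
  then show False
    by (simp add: one_GG nf_word properly_starts_def)
qed

lemma half_connected_gens_iff:
  "half_connected gens \<longleftrightarrow>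
    Digraph_Component.connected (living_subgraph \<G> living) \<and>
    dominating (living_subgraph \<G> living) (with_proj \<G>)"
proof -
  let ?E = "parcs \<G> \<inter> living \<times> living"
  have sub: "living \<subseteq> pverts \<G>"
    by (auto simp: living_def)
  have "(u, v) \<in> ?E\<^sup>*" if "half_connected gens" and uv: "u \<in> living" "v \<in> living" for u v
  proof (rule ccontr)
    assume uv': "(u, v) \<notin> ?E\<^sup>*"
    \<comment> \<open>Dead vertices are sent to the identity, and the living ones are divided into
      the component of \<open>u\<close> and the rest. Adjacent living vertices fall on the same
      side, and \<open>u\<close> and \<open>v\<close> on different sides.\<close>
    let ?val = "\<lambda>x. \<chi> (standard_generator \<G> x)"
    have "\<not> half_connected gens"
    proof (rule not_half_connected_if_splits[where side = "\<lambda>x. (u, x) \<notin> ?E\<^sup>*" and val = ?val and wt = "\<lambda>_. 1"])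
      show "?val x = 0 \<or> ?val y = 0 \<or> ((u, x) \<notin> ?E\<^sup>*) = ((u, y) \<notin> ?E\<^sup>*)"
        if xy: "(x, y) \<in> parcs \<G>" for x y
      proof (cases "?val x = 0 \<or> ?val y = 0")
        case False
        with xy have "(x, y) \<in> ?E" "(y, x) \<in> ?E"
          using parcs_sym by (auto simp: living_def dest: in_arcsD1 in_arcsD2)
        then show ?thesis
          by (meson rtrancl_into_rtrancl)
      qed blast
    qed (use uv uv' in \<open>auto simp: living_def\<close>)
    with that show False
      by blast
  qed
  moreover have "\<exists>w\<in>living. (v, w) \<in> parcs \<G>" if "half_connected gens" and v: "v \<in> pverts \<G> - living" for v
  proof (rule ccontr)
    assume no: "\<not> (\<exists>w\<in>living. (v, w) \<in> parcs \<G>)"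
    obtain a where a: "a \<in> living"
      using living_nonempty by blast
    \<comment> \<open>The dead vertex \<open>v\<close> gets a factor of its own, with value 1 to
      survive there and weight 0 to keep its height 0. All its neighbours are dead and get value 0,
      so no relation links the two factors.\<close>
    let ?val = "\<lambda>x. if x = v then 1 else \<chi> (standard_generator \<G> x)"
    have "\<not> half_connected gens"
    proof (rule not_half_connected_if_splits[where side = "\<lambda>x. x = v" and val = ?val and wt = "\<lambda>i. if i then 0 else 1"])
      show "?val x = 0 \<or> ?val y = 0 \<or> (x = v) = (y = v)" if xy: "(x, y) \<in> parcs \<G>" for x y
        using xy no parcs_sym[OF xy] by (auto simp: living_def dest: in_arcsD1 in_arcsD2)
    qed (use a v in \<open>auto simp: living_def\<close>)
    with that show False
      by blast
  qed
  ultimately show ?thesis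
    unfolding connected_living_subgraph_iff[OF sub] dominating_living_subgraph_iff
    using half_connected_if_connected_dominating living_nonempty by blast
qed

end

section \<open>Open simplices of the character sphere\<close>

context simplicial_graph
begin

text \<open>Letters act on the reals by translation by \<open>f v\<close> or its negative;
  translations commute, so the relations hold. The orbit of 0 gives the character, and
  \<open>v0\<close> makes it non-zero.\<close>

lemma character_exists:
  fixes f :: "'a \<Rightarrow> real"
  assumes "v0 \<in> pverts \<G>" "f v0 \<noteq> 0"
  shows "\<exists>\<chi>\<in>characters GG. \<forall>v\<in>pverts \<G>. \<chi> (standard_generator \<G> v) = f v"
proof -
  define act where "act = (\<lambda>(v, b) s. s + (if b then f v else - f v))"
  interpret presentation_action "pverts \<G>" "commutation_relations \<G>" act UNIV
    by unfold_locales (auto simp: act_def commutation_relations_def)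
  define \<chi> where "\<chi> = restrict (orbit_map 0) (carrier GG)"
  have word: "\<chi> (word_class w) = fold act w 0" if "w \<in> gwords (pverts \<G>)" for w
    using that orbit_map_word_class[of w 0] by (simp add: \<chi>_def carrier_GG)
  have shift: "fold act w s = s + fold act w 0" for w s
  proof (induction w arbitrary: s)
    case (Cons l w)
    show ?case
      using Cons.IH[of "act l s"] Cons.IH[of "act l 0"] by (simp add: act_def split: prod.splits)
  qed simp
  have gen: "\<chi> (standard_generator \<G> v) = f v" if "v \<in> pverts \<G>" for v
    using that by (simp add: standard_generator_eq word act_def)
  have "\<chi> (g \<otimes>\<^bsub>GG\<^esub> h) = \<chi> g + \<chi> h" if g: "g \<in> carrier GG" and h: "h \<in> carrier GG" for g h
  proof -
    obtain u where u: "u \<in> gwords (pverts \<G>)" "g = word_class u"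
      using g by (rule carrier_GG_E)
    obtain v where v: "v \<in> gwords (pverts \<G>)" "h = word_class v"
      using h by (rule carrier_GG_E)
    show ?thesis
      using u v shift[of v "fold act u 0"] by (simp add: mult_GG word)
  qed
  moreover have "standard_generator \<G> v0 \<in> carrier GG"
    using assms gens_subset by blast
  ultimately have "\<chi> \<in> characters GG"
    using assms(2) gen[OF assms(1)] unfolding characters_def hom_def real_group_def
    by (intro CollectI conjI IntI bexI[of _ "standard_generator \<G> v0"]) (simp_all add: \<chi>_def)
  with gen show ?thesis
    by blast
qed

text \<open>Membership in \<open>Sigma1\<close> speaks of some representative of the ray. All
  representatives have the same living vertices, so the criterion can be read off any of
  them.\<close>

lemma ray_in_Sigma1_iff:
  assumes X: "finite_generating_set GG X" and \<chi>: "\<chi> \<in> characters GG"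
    and A: "A = {v \<in> pverts \<G>. \<chi> (standard_generator \<G> v) \<noteq> 0}"
  shows "ray GG \<chi> \<in> Sigma1 GG X \<longleftrightarrow>
    Digraph_Component.connected (living_subgraph \<G> A) \<and>
    dominating (living_subgraph \<G> A) (with_proj \<G>)" (is "_ \<longleftrightarrow> ?good A")
proof -
  have X': "finite X" "X \<subseteq> carrier GG" "generate GG X = carrier GG"
    using X by (auto simp: finite_generating_set_def)
  have iff: "Digraph_Component.connected (nonneg_subgraph (cayley_graph GG X) \<psi>) \<longleftrightarrow>
      ?good {v \<in> pverts \<G>. \<psi> (standard_generator \<G> v) \<noteq> 0}" if "\<psi> \<in> characters GG" for \<psi>
  proof -
    interpret graph_character \<G> \<psi>
      by unfold_locales (rule that)
    have "half_connected X \<longleftrightarrow> half_connected gens"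
      using half_connected_change_generators[OF X'(2,3) character_nonzero gens_subset finite_gens]
        half_connected_change_generators[OF gens_subset generate_gens character_nonzero X'(2,1)]
      by blast
    then show ?thesis
      using connected_nonneg_subgraph_iff[OF X'(2)] half_connected_gens_iff
      by (simp add: living_def)
  qed
  have support: "{v \<in> pverts \<G>. \<psi> (standard_generator \<G> v) \<noteq> 0} = A"
    if "ray GG \<psi> = ray GG \<chi>" "\<psi> \<in> characters GG" for \<psi>
  proof -
    \<comment> \<open>By extensionality \<open>\<psi>\<close> lies in its own ray, hence it is a
      positive multiple of \<open>\<chi>\<close>.\<close>
    have "\<psi> = (\<lambda>g\<in>carrier GG. 1 * \<psi> g)"
      using that(2) by (auto simp: characters_def extensional_def restrict_def)
    then have "\<psi> \<in> ray GG \<psi>"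
      unfolding ray_def by (intro CollectI exI[of _ 1]) simp
    then have "\<psi> \<in> ray GG \<chi>"
      using that(1) by simp
    then obtain r where r: "r > 0" "\<psi> = (\<lambda>g\<in>carrier GG. r * \<chi> g)"
      unfolding ray_def by blast
    then have "\<psi> (standard_generator \<G> v) = r * \<chi> (standard_generator \<G> v)" if "v \<in> pverts \<G>" for v
      using that gens_subset by auto
    with r(1) show ?thesis
      by (auto simp: A)
  qed
  show ?thesis
  proof
    assume "ray GG \<chi> \<in> Sigma1 GG X"
    then obtain \<psi> where "ray GG \<chi> = ray GG \<psi>" "\<psi> \<in> characters GG"
      "Digraph_Component.connected (nonneg_subgraph (cayley_graph GG X) \<psi>)"
      unfolding Sigma1_def by blast
    then show "?good A"
      using iff[of \<psi>] support[of \<psi>] by simp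
  next
    assume "?good A"
    then show "ray GG \<chi> \<in> Sigma1 GG X"
      using iff[OF \<chi>] \<chi> unfolding Sigma1_def A by blast
  qed
qed

text \<open>Turns inclusion of a simplex in the invariant into a statement about an actual point.
  The witness takes the values \<open>\<epsilon> v\<close> on \<open>A\<close> and 0
  elsewhere.\<close>

lemma open_simplex_nonempty:
  assumes "signed_vertex_set \<G> A \<epsilon>"
  shows "open_simplex \<G> A \<epsilon> \<noteq> {}"
proof -
  have A: "A \<subseteq> pverts \<G>" "\<And>v. v \<in> A \<Longrightarrow> \<epsilon> v = 1 \<or> \<epsilon> v = -1"
    using assms by (auto simp: signed_vertex_set_def)
  obtain v0 where "v0 \<in> A"
    using assms by (auto simp: signed_vertex_set_def)
  then obtain \<chi> where \<chi>: "\<chi> \<in> characters GG"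
    "\<And>v. v \<in> pverts \<G> \<Longrightarrow> \<chi> (standard_generator \<G> v) = (if v \<in> A then \<epsilon> v else 0)"
    using character_exists[of v0 "\<lambda>v. if v \<in> A then \<epsilon> v else 0"] A by fastforce
  have "\<forall>v\<in>A. \<epsilon> v * \<chi> (standard_generator \<G> v) > 0"
    using A \<chi>(2) by (fastforce simp: subset_iff)
  moreover have "\<forall>v\<in>pverts \<G> - A. \<chi> (standard_generator \<G> v) = 0"
    using \<chi>(2) by simp
  ultimately show ?thesis
    using \<chi>(1) unfolding open_simplex_def by blast
qed

text \<open>The sign conditions make \<open>A\<close> exactly the set of living vertices, so
  membership is constant on an open simplex.\<close>

lemma open_simplex_in_Sigma1_iff:
  assumes X: "finite_generating_set GG X" and A: "signed_vertex_set \<G> A \<epsilon>"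
    and \<rho>: "\<rho> \<in> open_simplex \<G> A \<epsilon>"
  shows "\<rho> \<in> Sigma1 GG X \<longleftrightarrow>
    Digraph_Component.connected (living_subgraph \<G> A) \<and>
    dominating (living_subgraph \<G> A) (with_proj \<G>)"
proof -
  obtain \<chi> where \<chi>: "\<rho> = ray GG \<chi>" "\<chi> \<in> characters GG"
    "\<forall>v\<in>A. \<epsilon> v * \<chi> (standard_generator \<G> v) > 0"
    "\<forall>v\<in>pverts \<G> - A. \<chi> (standard_generator \<G> v) = 0"
    using \<rho> unfolding open_simplex_def by blast
  have "A = {v \<in> pverts \<G>. \<chi> (standard_generator \<G> v) \<noteq> 0}"
    using A \<chi>(3,4) by (auto simp: signed_vertex_set_def)
  then show ?thesis
    unfolding \<chi>(1) using X \<chi>(2) by (intro ray_in_Sigma1_iff)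
qed

text \<open>The open simplices cover the sphere: a character lies in the one given by its living
  vertices and the signs of its values there.\<close>

lemma in_open_simplex:
  assumes "\<rho> \<in> character_sphere GG"
  shows "\<exists>A \<epsilon>. signed_vertex_set \<G> A \<epsilon> \<and> \<rho> \<in> open_simplex \<G> A \<epsilon>"
proof -
  obtain \<chi> where \<chi>: "\<rho> = ray GG \<chi>" "\<chi> \<in> characters GG"
    using assms unfolding character_sphere_def by blast
  interpret graph_character \<G> \<chi>
    by unfold_locales (rule \<chi>(2))
  define \<epsilon> where "\<epsilon> = (\<lambda>v\<in>living. sgn (\<chi> (standard_generator \<G> v)))"
  have "signed_vertex_set \<G> living \<epsilon>"
    using living_nonempty by (auto simp: signed_vertex_set_def living_def \<epsilon>_def sgn_if)
  moreover have "\<forall>v\<in>living. \<epsilon> v * \<chi> (standard_generator \<G> v) > 0"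
    by (auto simp: \<epsilon>_def living_def sgn_if)
  moreover have "\<forall>v\<in>pverts \<G> - living. \<chi> (standard_generator \<G> v) = 0"
    by (auto simp: living_def)
  ultimately show ?thesis
    using \<chi> unfolding open_simplex_def by blast
qed

end

theorem theorem5p1:
  fixes \<G> :: "'a pair_pre_digraph" and X :: "'a gword set set"
  assumes "pair_graph \<G>"
    and "finite_generating_set (graph_group \<G>) X"
  shows "Sigma1 (graph_group \<G>) X \<subseteq> character_sphere (graph_group \<G>)
    \<and> (\<exists>F \<subseteq> open_simplices \<G>. Sigma1 (graph_group \<G>) X = \<Union>F)
    \<and> (\<forall>A \<epsilon>. signed_vertex_set \<G> A \<epsilon> \<longrightarrow>
         (open_simplex \<G> A \<epsilon> \<subseteq> Sigma1 (graph_group \<G>) X \<longleftrightarrow>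
            Digraph_Component.connected (living_subgraph \<G> A) \<and>
            dominating (living_subgraph \<G> A) (with_proj \<G>)))"
proof -
  interpret simplicial_graph \<G>
    using assms(1) by (simp add: simplicial_graph_def)
  note simplex_iff = open_simplex_in_Sigma1_iff[OF assms(2)]
  have sphere: "Sigma1 GG X \<subseteq> character_sphere GG"
    unfolding Sigma1_def character_sphere_def by blast
  \<comment> \<open>A single point of the invariant brings in its whole open simplex, so the union
    of all contained simplices exhausts the invariant.\<close>
  have whole: "open_simplex \<G> A \<epsilon> \<subseteq> Sigma1 GG X"
    if "signed_vertex_set \<G> A \<epsilon>" "\<rho> \<in> open_simplex \<G> A \<epsilon>" "\<rho> \<in> Sigma1 GG X" for A \<epsilon> \<rho>
    using simplex_iff[OF that(1)] that(2,3) by blast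
  let ?F = "{\<sigma> \<in> open_simplices \<G>. \<sigma> \<subseteq> Sigma1 GG X}"
  have "Sigma1 GG X \<subseteq> \<Union>?F"
  proof
    fix \<rho> assume \<rho>: "\<rho> \<in> Sigma1 GG X"
    then obtain A \<epsilon> where "signed_vertex_set \<G> A \<epsilon>" "\<rho> \<in> open_simplex \<G> A \<epsilon>"
      using in_open_simplex sphere by blast
    with \<rho> whole show "\<rho> \<in> \<Union>?F"
      unfolding open_simplices_def by blast
  qed
  then have "\<exists>F \<subseteq> open_simplices \<G>. Sigma1 GG X = \<Union>F"
    by (intro exI[of _ ?F]) blast
  moreover have "open_simplex \<G> A \<epsilon> \<subseteq> Sigma1 GG X \<longleftrightarrow>
      Digraph_Component.connected (living_subgraph \<G> A) \<and>
      dominating (living_subgraph \<G> A) (with_proj \<G>)" if "signed_vertex_set \<G> A \<epsilon>" for A \<epsilon>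
    using simplex_iff[OF that] open_simplex_nonempty[OF that] by blast
  ultimately show ?thesis
    using sphere by blast
qed

end
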